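(* $\mathcal B(\ell_1)$ and $\mathcal B(c_0)$ both have the BCP.
   Context: $\mathcal B(Z)$ is the space of bounded linear operators from $Z$ to itself with the operator norm. A normed space $X$ has the ball-covering property (BCP) if its unit sphere $S_X=\{x:\|x\|=1\}$ can be covered by countably many closed (equivalently, open) balls, none of which contains the origin. *)

theory Defs
  imports "HOL-Analysis.Analysis"
begin

text \<open>
  The sequence spaces are built over an arbitrary normed field \<open>'k\<close>, to be instantiated with the real
  and the complex numbers.
\<close>

typedef (overloaded) 'k ell1 = "{x :: nat \<Rightarrow> 'k::real_normed_field. summable (\<lambda>n. norm (x n))}"
  morphisms ell1_nth Abs_ell1
  by (rule exI[of _ "\<lambda>_. 0"]) simp

setup_lifting type_definition_ell1

instantiation ell1 :: (real_normed_field) real_normed_vector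
begin

lift_definition zero_ell1 :: "'a ell1" is "\<lambda>_. 0"
  by simp

lift_definition plus_ell1 :: "'a ell1 \<Rightarrow> 'a ell1 \<Rightarrow> 'a ell1" is "\<lambda>x y n. x n + y n"
  subgoal for x y
    by (rule summable_comparison_test'[where g = "\<lambda>n. norm (x n) + norm (y n)"])
      (auto intro: summable_add norm_triangle_ineq)
  done

lift_definition uminus_ell1 :: "'a ell1 \<Rightarrow> 'a ell1" is "\<lambda>x n. - x n"
  by simp

lift_definition minus_ell1 :: "'a ell1 \<Rightarrow> 'a ell1 \<Rightarrow> 'a ell1" is "\<lambda>x y n. x n - y n"
  subgoal for x y
    by (rule summable_comparison_test'[where g = "\<lambda>n. norm (x n) + norm (y n)"])
      (auto intro: summable_add norm_triangle_ineq4)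
  done

lift_definition scaleR_ell1 :: "real \<Rightarrow> 'a ell1 \<Rightarrow> 'a ell1" is "\<lambda>r x n. r *\<^sub>R x n"
  by (simp add: summable_mult)

lift_definition norm_ell1 :: "'a ell1 \<Rightarrow> real" is "\<lambda>x. \<Sum>n. norm (x n)" .

definition sgn_ell1 :: "'a ell1 \<Rightarrow> 'a ell1"
  where "sgn_ell1 x = inverse (norm x) *\<^sub>R x"

definition dist_ell1 :: "'a ell1 \<Rightarrow> 'a ell1 \<Rightarrow> real"
  where "dist_ell1 x y = norm (x - y)"

definition uniformity_ell1 :: "('a ell1 \<times> 'a ell1) filter"
  where "uniformity_ell1 = (INF e\<in>{0<..}. principal {(x, y). dist x y < e})"

definition open_ell1 :: "'a ell1 set \<Rightarrow> bool"
  where "open_ell1 U \<longleftrightarrow> (\<forall>x\<in>U. \<forall>\<^sub>F (x', y) in uniformity. x' = x \<longrightarrow> y \<in> U)"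

instance
proof
  fix x y z :: "'a ell1" and a b :: real
  show "x + y + z = x + (y + z)" by transfer (simp add: add.assoc)
  show "x + y = y + x" by transfer (simp add: add.commute)
  show "0 + x = x" by transfer simp
  show "- x + x = 0" by transfer simp
  show "x - y = x + - y" by transfer simp
  show "a *\<^sub>R (x + y) = a *\<^sub>R x + a *\<^sub>R y" by transfer (simp add: scaleR_add_right)
  show "(a + b) *\<^sub>R x = a *\<^sub>R x + b *\<^sub>R x" by transfer (simp add: scaleR_add_left)
  show "a *\<^sub>R b *\<^sub>R x = (a * b) *\<^sub>R x" by transfer simp
  show "1 *\<^sub>R x = x" by transfer simp
  show "sgn x = inverse (norm x) *\<^sub>R x" by (fact sgn_ell1_def)
  show "dist x y = norm (x - y)" by (fact dist_ell1_def)
  show "(uniformity :: ('a ell1 \<times> 'a ell1) filter)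
      = (INF e\<in>{0<..}. principal {(x, y). dist x y < e})" by (fact uniformity_ell1_def)
  show "open U \<longleftrightarrow> (\<forall>x\<in>U. \<forall>\<^sub>F (x', y) in uniformity. x' = x \<longrightarrow> y \<in> U)"
    for U :: "'a ell1 set" by (fact open_ell1_def)
  show "norm x = 0 \<longleftrightarrow> x = 0"
    by transfer (simp add: suminf_eq_zero_iff fun_eq_iff)
  show "norm (x + y) \<le> norm x + norm y"
  proof transfer
    fix x y :: "nat \<Rightarrow> 'a"
    assume x: "summable (\<lambda>n. norm (x n))" and y: "summable (\<lambda>n. norm (y n))"
    have "summable (\<lambda>n. norm (x n + y n))"
      by (rule summable_comparison_test'[OF summable_add[OF x y]]) (auto intro: norm_triangle_ineq)
    then have "(\<Sum>n. norm (x n + y n)) \<le> (\<Sum>n. norm (x n) + norm (y n))"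
      by (intro suminf_le summable_add x y norm_triangle_ineq)
    then show "(\<Sum>n. norm (x n + y n)) \<le> (\<Sum>n. norm (x n)) + (\<Sum>n. norm (y n))"
      by (simp add: suminf_add x y)
  qed
  show "norm (a *\<^sub>R x) = \<bar>a\<bar> * norm x"
    by transfer (simp add: suminf_mult)
qed

end

lift_definition scale_ell1 :: "'k::real_normed_field \<Rightarrow> 'k ell1 \<Rightarrow> 'k ell1" is "\<lambda>c x n. c * x n"
  by (simp add: norm_mult summable_mult)

typedef (overloaded) 'k c0 = "{x :: nat \<Rightarrow> 'k::real_normed_field. x \<longlonglongrightarrow> 0}"
  morphisms c0_nth Abs_c0
  by (rule exI[of _ "\<lambda>_. 0"]) simp

setup_lifting type_definition_c0

lemma null_sequence_bdd_above:
  fixes x :: "nat \<Rightarrow> 'k::real_normed_field"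
  assumes "x \<longlonglongrightarrow> 0"
  shows "bdd_above (range (\<lambda>n. norm (x n)))"
proof -
  have "Bseq x" using assms by (intro convergent_imp_Bseq convergentI)
  then show ?thesis by (auto simp: Bseq_def intro: bdd_aboveI)
qed

instantiation c0 :: (real_normed_field) real_normed_vector
begin

lift_definition zero_c0 :: "'a c0" is "\<lambda>_. 0"
  by simp

lift_definition plus_c0 :: "'a c0 \<Rightarrow> 'a c0 \<Rightarrow> 'a c0" is "\<lambda>x y n. x n + y n"
  by (rule tendsto_add_zero)

lift_definition uminus_c0 :: "'a c0 \<Rightarrow> 'a c0" is "\<lambda>x n. - x n"
  using tendsto_minus by fastforce

lift_definition minus_c0 :: "'a c0 \<Rightarrow> 'a c0 \<Rightarrow> 'a c0" is "\<lambda>x y n. x n - y n"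
  using tendsto_diff by fastforce

lift_definition scaleR_c0 :: "real \<Rightarrow> 'a c0 \<Rightarrow> 'a c0" is "\<lambda>r x n. r *\<^sub>R x n"
  by (rule tendsto_scaleR[OF tendsto_const, of _ 0, simplified])

lift_definition norm_c0 :: "'a c0 \<Rightarrow> real" is "\<lambda>x. SUP n. norm (x n)" .

definition sgn_c0 :: "'a c0 \<Rightarrow> 'a c0"
  where "sgn_c0 x = inverse (norm x) *\<^sub>R x"

definition dist_c0 :: "'a c0 \<Rightarrow> 'a c0 \<Rightarrow> real"
  where "dist_c0 x y = norm (x - y)"

definition uniformity_c0 :: "('a c0 \<times> 'a c0) filter"
  where "uniformity_c0 = (INF e\<in>{0<..}. principal {(x, y). dist x y < e})"

definition open_c0 :: "'a c0 set \<Rightarrow> bool"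
  where "open_c0 U \<longleftrightarrow> (\<forall>x\<in>U. \<forall>\<^sub>F (x', y) in uniformity. x' = x \<longrightarrow> y \<in> U)"

instance
proof
  fix x y z :: "'a c0" and a b :: real
  show "x + y + z = x + (y + z)" by transfer (simp add: add.assoc)
  show "x + y = y + x" by transfer (simp add: add.commute)
  show "0 + x = x" by transfer simp
  show "- x + x = 0" by transfer simp
  show "x - y = x + - y" by transfer simp
  show "a *\<^sub>R (x + y) = a *\<^sub>R x + a *\<^sub>R y" by transfer (simp add: scaleR_add_right)
  show "(a + b) *\<^sub>R x = a *\<^sub>R x + b *\<^sub>R x" by transfer (simp add: scaleR_add_left)
  show "a *\<^sub>R b *\<^sub>R x = (a * b) *\<^sub>R x" by transfer simp
  show "1 *\<^sub>R x = x" by transfer simp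
  show "sgn x = inverse (norm x) *\<^sub>R x" by (fact sgn_c0_def)
  show "dist x y = norm (x - y)" by (fact dist_c0_def)
  show "(uniformity :: ('a c0 \<times> 'a c0) filter)
      = (INF e\<in>{0<..}. principal {(x, y). dist x y < e})" by (fact uniformity_c0_def)
  show "open U \<longleftrightarrow> (\<forall>x\<in>U. \<forall>\<^sub>F (x', y) in uniformity. x' = x \<longrightarrow> y \<in> U)"
    for U :: "'a c0 set" by (fact open_c0_def)
  show "norm x = 0 \<longleftrightarrow> x = 0"
  proof transfer
    fix x :: "nat \<Rightarrow> 'a"
    assume "x \<longlonglongrightarrow> 0"
    then have "norm (x n) \<le> (SUP n. norm (x n))" for n
      by (intro cSUP_upper null_sequence_bdd_above) simp_all
    then show "(SUP n. norm (x n)) = 0 \<longleftrightarrow> x = (\<lambda>_. 0)"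
      by (auto simp: fun_eq_iff)
  qed
  show "norm (x + y) \<le> norm x + norm y"
  proof transfer
    fix x y :: "nat \<Rightarrow> 'a"
    assume "x \<longlonglongrightarrow> 0" "y \<longlonglongrightarrow> 0"
    then have "norm (x n) \<le> (SUP n. norm (x n))" "norm (y n) \<le> (SUP n. norm (y n))" for n
      by (auto intro!: cSUP_upper null_sequence_bdd_above)
    then show "(SUP n. norm (x n + y n)) \<le> (SUP n. norm (x n)) + (SUP n. norm (y n))"
      by (intro cSUP_least) (auto intro: norm_triangle_mono)
  qed
  show "norm (a *\<^sub>R x) = \<bar>a\<bar> * norm x"
  proof transfer
    fix a :: real and x :: "nat \<Rightarrow> 'a"
    assume "x \<longlonglongrightarrow> 0"
    then have "\<bar>a\<bar> * Sup (range (\<lambda>n. norm (x n))) = (SUP t\<in>range (\<lambda>n. norm (x n)). \<bar>a\<bar> * t)"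
      by (intro continuous_at_Sup_mono null_sequence_bdd_above)
        (auto intro!: monoI mult_left_mono continuous_intros)
    then show "(SUP n. norm (a *\<^sub>R x n)) = \<bar>a\<bar> * (SUP n. norm (x n))"
      by (simp add: image_image)
  qed
qed

end

lift_definition scale_c0 :: "'k::real_normed_field \<Rightarrow> 'k c0 \<Rightarrow> 'k c0" is "\<lambda>c x n. c * x n"
  by (rule tendsto_mult_right_zero)

text \<open>
  The type of bounded linear functions of the library consists of the real-linear maps. The bounded
  operators over the field \<open>'k\<close> form the subspace of those that commute with multiplication by all
  scalars from \<open>'k\<close>; they carry the operator norm of the library.
\<close>

definition bounded_ops_ell1 :: "('k::real_normed_field ell1 \<Rightarrow>\<^sub>L 'k ell1) set"
  where "bounded_ops_ell1 = {T. \<forall>c x. blinfun_apply T (scale_ell1 c x) = scale_ell1 c (blinfun_apply T x)}"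

definition bounded_ops_c0 :: "('k::real_normed_field c0 \<Rightarrow>\<^sub>L 'k c0) set"
  where "bounded_ops_c0 = {T. \<forall>c x. blinfun_apply T (scale_c0 c x) = scale_c0 c (blinfun_apply T x)}"

lemma subspace_bounded_ops_ell1: "subspace (bounded_ops_ell1 :: ('k::real_normed_field ell1 \<Rightarrow>\<^sub>L 'k ell1) set)"
proof -
  have "scale_ell1 c (x + y) = scale_ell1 c x + scale_ell1 c y" "scale_ell1 c 0 = 0"
    "scale_ell1 c (r *\<^sub>R x) = r *\<^sub>R scale_ell1 c x" for c :: 'k and x y r
    by (transfer; simp add: algebra_simps)+
  then show ?thesis
    by (auto simp: subspace_def bounded_ops_ell1_def blinfun.bilinear_simps)
qed

lemma subspace_bounded_ops_c0: "subspace (bounded_ops_c0 :: ('k::real_normed_field c0 \<Rightarrow>\<^sub>L 'k c0) set)"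
proof -
  have "scale_c0 c (x + y) = scale_c0 c x + scale_c0 c y" "scale_c0 c 0 = 0"
    "scale_c0 c (r *\<^sub>R x) = r *\<^sub>R scale_c0 c x" for c :: 'k and x y r
    by (transfer; simp add: algebra_simps)+
  then show ?thesis
    by (auto simp: subspace_def bounded_ops_c0_def blinfun.bilinear_simps)
qed

lemma bounded_ops_ell1_real: "(bounded_ops_ell1 :: (real ell1 \<Rightarrow>\<^sub>L real ell1) set) = UNIV"
proof -
  have "scale_ell1 c x = c *\<^sub>R x" for c :: real and x
    by transfer simp
  then show ?thesis
    by (auto simp: bounded_ops_ell1_def blinfun.scaleR_right)
qed

lemma bounded_ops_c0_real: "(bounded_ops_c0 :: (real c0 \<Rightarrow>\<^sub>L real c0) set) = UNIV"
proof -
  have "scale_c0 c x = c *\<^sub>R x" for c :: real and x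
    by transfer simp
  then show ?thesis
    by (auto simp: bounded_ops_c0_def blinfun.scaleR_right)
qed

text \<open>
  The normed space is given as a subspace \<open>X\<close> of an ambient normed space. The centres of the balls have
  to lie in \<open>X\<close>, so that the traces of the balls on \<open>X\<close> are balls of \<open>X\<close>.
\<close>

definition ball_covering_property :: "'a::real_normed_vector set \<Rightarrow> bool"
  where "ball_covering_property X \<longleftrightarrow>
    (\<exists>B :: ('a \<times> real) set. countable B \<and>
      (\<forall>(c, r)\<in>B. c \<in> X \<and> r > 0 \<and> 0 \<notin> cball c r) \<and>
      {x \<in> X. norm x = 1} \<subseteq> (\<Union>(c, r)\<in>B. cball c r))"

end

theory Submission
  imports Defs
begin

text \<open>
  An operator on \<open>\<ell>\<^sub>1\<close> is determined by its columns, an operator on \<open>c\<^sub>0\<close> by its rows. Both are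
  elements of \<open>\<ell>\<^sub>1\<close>, and the operator norm is the supremum of their norms. If \<open>T\<close> has norm 1, some
  column (row) \<open>v\<close> has norm greater than \<open>1/2\<close>. Let \<open>C\<close> be the operator whose only nonzero column
  (row), in the same position, is \<open>4y\<close>, where \<open>y\<close> is an approximation of \<open>v\<close> from a countable dense
  subset of \<open>\<ell>\<^sub>1\<close>. Then \<open>norm (T - C)\<close> is about \<open>max 1 (3 * norm v)\<close> and \<open>norm C\<close> is about
  \<open>4 * norm v\<close>, so that a ball around \<open>C\<close> contains \<open>T\<close> but not the origin.
\<close>

section \<open>Coverings from countable sets of centres\<close>

text \<open>Any rational radius strictly between \<open>norm (x - c)\<close> and
  \<open>norm c\<close> puts \<open>x\<close> into the ball around \<open>c\<close> and keeps the
  origin out. Rational radii leave only countably many balls.\<close>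

lemma ball_covering_propertyI:
  fixes X :: "'a::real_normed_vector set"
  assumes "countable D" "D \<subseteq> X"
    and near: "\<And>x. x \<in> X \<Longrightarrow> norm x = 1 \<Longrightarrow> \<exists>c\<in>D. norm (x - c) < norm c"
  shows "ball_covering_property X"
proof -
  define B where "B = {(c, r) \<in> D \<times> \<rat>. 0 < r \<and> r < norm c}"
  have "countable B"
    unfolding B_def using assms(1) countable_rat
    by (intro countable_subset[OF _ countable_SIGMA[of D "\<lambda>_. \<rat>"]]) auto
  moreover have "\<forall>(c, r)\<in>B. c \<in> X \<and> r > 0 \<and> 0 \<notin> cball c r"
    using assms(2) by (auto simp: B_def)
  moreover have "x \<in> (\<Union>(c, r)\<in>B. cball c r)" if x: "x \<in> X" "norm x = 1" for x
  proof -
    obtain c where c: "c \<in> D" "norm (x - c) < norm c"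
      using near[OF x] by blast
    obtain r where r: "r \<in> \<rat>" "norm (x - c) < r" "r < norm c"
      using Rats_dense_in_real[OF c(2)] by blast
    have "0 < r"
      using r(2) norm_ge_zero[of "x - c"] by linarith
    then have "(c, r) \<in> B" "x \<in> cball c r"
      using c r by (auto simp: B_def dist_norm norm_minus_commute)
    then show ?thesis by blast
  qed
  ultimately show ?thesis
    unfolding ball_covering_property_def by (intro exI[of _ B]) blast
qed

text \<open>Common form of both cases: \<open>A i\<close> reads off the \<open>i\<close>-th column
  or row, and \<open>R j y\<close> is the operator with \<open>y\<close> in position
  \<open>j\<close> and zero elsewhere. Together \<open>A_le\<close> and \<open>norm_le\<close> say
  that the norm is the supremum of the coordinate norms. The hypotheses on \<open>A\<close> for
  general operators are restricted to \<open>X\<close> because rows are controlled only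
  there.\<close>

lemma ball_covering_property_coordinates:
  fixes X :: "'w::real_normed_vector set"
    and A :: "nat \<Rightarrow> 'w \<Rightarrow> 'v::real_normed_vector"
    and R :: "nat \<Rightarrow> 'v \<Rightarrow> 'w"
    and Y :: "'v set"
  assumes "subspace X"
    and R: "\<And>j y. R j y \<in> X"
    and AR: "\<And>i j y. A i (R j y) = (if i = j then y else 0)"
    and A_diff: "\<And>i S T. S \<in> X \<Longrightarrow> T \<in> X \<Longrightarrow> A i (S - T) = A i S - A i T"
    and A_le: "\<And>i T. T \<in> X \<Longrightarrow> norm (A i T) \<le> norm T"
    and norm_le: "\<And>T M. T \<in> X \<Longrightarrow> (\<And>i. norm (A i T) \<le> M) \<Longrightarrow> norm T \<le> M"
    and Y: "countable Y" "\<And>v e. 0 < e \<Longrightarrow> \<exists>y\<in>Y. norm (v - y) < e"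
  shows "ball_covering_property X"
proof (rule ball_covering_propertyI)
  show "countable ((\<lambda>(j, y). R j (4 *\<^sub>R y)) ` (UNIV \<times> Y))"
    using Y(1) by simp
  show "(\<lambda>(j, y). R j (4 *\<^sub>R y)) ` (UNIV \<times> Y) \<subseteq> X"
    using R by auto
  fix T assume T: "T \<in> X" "norm T = 1"
  have "\<not> (\<forall>j. norm (A j T) \<le> 1/2)"
    using norm_le[of T "1/2"] T by auto
  then obtain j where j: "1/2 < norm (A j T)"
    by (auto simp: not_le)
  \<comment> \<open>Scaling by 4 turns the error 1/32 into 1/8. With \<open>v = A j T\<close> and
    \<open>norm v > 1/2\<close>, both 1 and \<open>3 * norm v + 1/8\<close> stay below
    \<open>4 * norm v - 1/8\<close>, which is less than \<open>4 * norm y\<close>.\<close>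
  obtain y where y: "y \<in> Y" "norm (A j T - y) < 1/32"
    using Y(2)[of "1/32" "A j T"] by auto
  define C where "C = R j (4 *\<^sub>R y)"
  have C: "C \<in> X" by (simp add: C_def R)
  have y_ge: "norm (A j T) - 1/32 < norm y"
    using y(2) norm_triangle_ineq2[of "A j T" y] by linarith
  have "norm (A i (T - C)) \<le> max 1 (3 * norm (A j T) + 1/8)" for i
  proof (cases "i = j")
    case True
    have "A j T - 4 *\<^sub>R y = 4 *\<^sub>R (A j T - y) - 3 *\<^sub>R A j T"
      using scaleR_left_distrib[of 1 3 "A j T"] by (simp add: algebra_simps)
    then have "norm (A j T - 4 *\<^sub>R y) \<le> 4 * norm (A j T - y) + 3 * norm (A j T)"
      using norm_triangle_ineq4[of "4 *\<^sub>R (A j T - y)" "3 *\<^sub>R A j T"] by simp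
    then show ?thesis
      using y(2) True by (simp add: A_diff T C) (simp add: C_def AR)
  next
    case False
    then show ?thesis
      using A_le[OF T(1), of i] T(2) by (simp add: A_diff T C) (simp add: C_def AR)
  qed
  then have "norm (T - C) \<le> max 1 (3 * norm (A j T) + 1/8)"
    using assms(1) T(1) C by (intro norm_le subspace_diff)
  also have "\<dots> < 4 * norm y"
    using y_ge j by auto
  also have "\<dots> \<le> norm C"
    using A_le[OF C, of j] by (simp add: C_def AR)
  finally show "\<exists>c\<in>(\<lambda>(j, y). R j (4 *\<^sub>R y)) ` (UNIV \<times> Y). norm (T - c) < norm c"
    using y(1) by (force simp: C_def)
qed

section \<open>Coordinates, truncations and separability\<close>

lemma ell1_eqI: "(\<And>n. ell1_nth x n = ell1_nth y n) \<Longrightarrow> x = y"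
  by transfer auto

lemma c0_eqI: "(\<And>n. c0_nth x n = c0_nth y n) \<Longrightarrow> x = y"
  by transfer auto

lemmas ell1_nth_simps [simp] =
  zero_ell1.rep_eq plus_ell1.rep_eq minus_ell1.rep_eq scaleR_ell1.rep_eq scale_ell1.rep_eq

lemmas c0_nth_simps [simp] =
  zero_c0.rep_eq plus_c0.rep_eq minus_c0.rep_eq scaleR_c0.rep_eq scale_c0.rep_eq

lemma ell1_nth_sum [simp]: "ell1_nth (\<Sum>a\<in>S. f a) n = (\<Sum>a\<in>S. ell1_nth (f a) n)"
  by (induction S rule: infinite_finite_induct) auto

lemma c0_nth_sum [simp]: "c0_nth (\<Sum>a\<in>S. f a) n = (\<Sum>a\<in>S. c0_nth (f a) n)"
  by (induction S rule: infinite_finite_induct) auto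

lemma summable_ell1_nth: "summable (\<lambda>n. norm (ell1_nth x n))"
  using ell1_nth by blast

lemma c0_nth_tendsto: "c0_nth x \<longlonglongrightarrow> 0"
  using c0_nth by blast

lemma norm_ell1_sum_le: "finite S \<Longrightarrow> (\<Sum>n\<in>S. norm (ell1_nth x n)) \<le> norm x"
  unfolding norm_ell1.rep_eq by (intro sum_le_suminf summable_ell1_nth) auto

lemma norm_ell1_nth_le: "norm (ell1_nth x n) \<le> norm x"
  using norm_ell1_sum_le[of "{n}" x] by simp

lemma norm_c0_nth_le: "norm (c0_nth x n) \<le> norm x"
  unfolding norm_c0.rep_eq
  by (intro cSUP_upper null_sequence_bdd_above c0_nth_tendsto) simp

lemma norm_c0_leI: "(\<And>n. norm (c0_nth x n) \<le> M) \<Longrightarrow> norm x \<le> M"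
  unfolding norm_c0.rep_eq by (intro cSUP_least) auto

lemma norm_scale_ell1: "norm (scale_ell1 c x) = norm c * norm x"
  unfolding norm_ell1.rep_eq by (simp add: norm_mult suminf_mult summable_ell1_nth)

lemma scale_ell1_diff: "scale_ell1 (c - d) x = scale_ell1 c x - scale_ell1 d x"
  by (rule ell1_eqI) (simp add: algebra_simps)

lift_definition unit_ell1 :: "nat \<Rightarrow> 'k::real_normed_field ell1" is "\<lambda>n m. of_bool (m = n)"
  subgoal for n by (rule summable_finite[of "{n}"]) auto
  done

lift_definition unit_c0 :: "nat \<Rightarrow> 'k::real_normed_field c0" is "\<lambda>n m. of_bool (m = n)"
  subgoal for n
    by (rule tendsto_eventually, rule eventually_sequentiallyI[of "Suc n"]) auto
  done

lemmas unit_nth [simp] = unit_ell1.rep_eq unit_c0.rep_eq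

lemma norm_unit_ell1 [simp]: "norm (unit_ell1 n) = 1"
  unfolding norm_ell1.rep_eq by (subst suminf_finite[of "{n}"]) auto

lemma sum_of_bool_nth:
  fixes a :: "nat \<Rightarrow> 'k::real_normed_field"
  shows "(\<Sum>j<n. a j * of_bool (m = j)) = (if m < n then a m else 0)"
  by (simp add: of_bool_def if_distrib sum.delta cong: if_cong)

text \<open>Written as a finite combination of unit vectors so that linear operators pass through
  the sum. The coefficients are an arbitrary function, since truncations of sequences outside the
  space are also formed.\<close>

definition trunc_ell1 :: "nat \<Rightarrow> (nat \<Rightarrow> 'k::real_normed_field) \<Rightarrow> 'k ell1"
  where "trunc_ell1 n a = (\<Sum>j<n. scale_ell1 (a j) (unit_ell1 j))"

definition trunc_c0 :: "nat \<Rightarrow> (nat \<Rightarrow> 'k::real_normed_field) \<Rightarrow> 'k c0"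
  where "trunc_c0 n a = (\<Sum>j<n. scale_c0 (a j) (unit_c0 j))"

lemma trunc_nth [simp]:
  "ell1_nth (trunc_ell1 n a) m = (if m < n then a m else 0)"
  "c0_nth (trunc_c0 n a) m = (if m < n then a m else 0)"
  by (simp_all add: trunc_ell1_def trunc_c0_def sum_of_bool_nth)

text \<open>The error is exactly the tail of the convergent series that defines
  \<open>norm x\<close>.\<close>

lemma trunc_ell1_tendsto: "(\<lambda>n. trunc_ell1 n (ell1_nth x)) \<longlonglongrightarrow> x"
proof -
  have "norm (trunc_ell1 n (ell1_nth x) - x) = norm x - (\<Sum>j<n. norm (ell1_nth x j))" for n
  proof -
    have "(\<lambda>m. norm (ell1_nth x m)) sums norm x"
      unfolding norm_ell1.rep_eq by (intro summable_sums summable_ell1_nth)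
    moreover have "(\<lambda>m. if m \<in> {..<n} then norm (ell1_nth x m) else 0) sums (\<Sum>j<n. norm (ell1_nth x j))"
      by (rule sums_If_finite_set) simp
    ultimately have "(\<lambda>m. norm (ell1_nth x m) - (if m \<in> {..<n} then norm (ell1_nth x m) else 0))
        sums (norm x - (\<Sum>j<n. norm (ell1_nth x j)))"
      by (rule sums_diff)
    moreover have "(\<lambda>m. norm (ell1_nth x m) - (if m \<in> {..<n} then norm (ell1_nth x m) else 0))
        = (\<lambda>m. norm (ell1_nth (trunc_ell1 n (ell1_nth x) - x) m))"
      by auto
    ultimately have "(\<lambda>m. norm (ell1_nth (trunc_ell1 n (ell1_nth x) - x) m))
        sums (norm x - (\<Sum>j<n. norm (ell1_nth x j)))"
      by (simp only:)
    then show ?thesis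
      unfolding norm_ell1.rep_eq[of "_ - _"] by (rule sums_unique[symmetric])
  qed
  moreover have "(\<lambda>n. norm x - (\<Sum>j<n. norm (ell1_nth x j))) \<longlonglongrightarrow> norm x - norm x"
    unfolding norm_ell1.rep_eq[of x] by (intro tendsto_intros summable_LIMSEQ summable_ell1_nth)
  ultimately show ?thesis
    by (simp add: LIM_zero_cancel[OF tendsto_norm_zero_cancel])
qed

lemma trunc_c0_tendsto: "(\<lambda>n. trunc_c0 n (c0_nth x)) \<longlonglongrightarrow> x"
proof (rule LIMSEQ_I)
  fix e :: real assume "0 < e"
  then obtain N where N: "\<And>m. m \<ge> N \<Longrightarrow> norm (c0_nth x m) < e/2"
    using LIMSEQ_D[OF c0_nth_tendsto, of "e/2" x] by auto
  \<comment> \<open>A supremum of entries below \<open>e/2\<close> is only bounded by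
    \<open>e/2\<close> weakly; halving \<open>e\<close> restores the strict inequality.\<close>
  have "norm (trunc_c0 n (c0_nth x) - x) \<le> e/2" if "n \<ge> N" for n
    using that \<open>0 < e\<close> less_imp_le[OF N] by (intro norm_c0_leI) simp
  then show "\<exists>N. \<forall>n\<ge>N. norm (trunc_c0 n (c0_nth x) - x) < e"
    using \<open>0 < e\<close> by (intro exI[of _ N]) force
qed

text \<open>Finitely supported sequences with entries from a countable dense subset of the field are
  dense. Encoding them by lists makes their countability immediate.\<close>

lemma ell1_separable:
  obtains Y :: "'k::{real_normed_field, second_countable_topology} ell1 set"
  where "countable Y" "\<And>x e. 0 < e \<Longrightarrow> \<exists>y\<in>Y. norm (x - y) < e"
proof -
  obtain D :: "'k set" where D: "countable D" "\<And>U. open U \<Longrightarrow> U \<noteq> {} \<Longrightarrow> \<exists>d\<in>D. d \<in> U"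
    using countable_dense_setE by metis
  define Y where "Y = (\<lambda>l. trunc_ell1 (length l) (\<lambda>j. l ! j)) ` lists D"
  show thesis
  proof
    show "countable Y" using D(1) by (simp add: Y_def)
    fix x :: "'k ell1" and e :: real assume e: "0 < e"
    obtain n where n: "norm (trunc_ell1 n (ell1_nth x) - x) < e/2"
      using LIMSEQ_D[OF trunc_ell1_tendsto, of "e/2" x] e by auto
    \<comment> \<open>The \<open>n\<close> coordinate errors add up to at most \<open>e/2\<close>;
      the added 1 keeps \<open>d\<close> positive when \<open>n = 0\<close>.\<close>
    define d where "d = e / (2 * (real n + 1))"
    have d: "0 < d" using e by (simp add: d_def)
    have "\<exists>q\<in>D. dist (ell1_nth x j) q < d" for j
      using D(2)[of "ball (ell1_nth x j) d"] d by auto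
    then obtain q where q: "\<And>j. q j \<in> D" "\<And>j. dist (ell1_nth x j) (q j) < d"
      by metis
    have "trunc_ell1 n q = trunc_ell1 (length (map q [0..<n])) (\<lambda>j. map q [0..<n] ! j)"
      by (intro ell1_eqI) auto
    then have mem: "trunc_ell1 n q \<in> Y"
      unfolding Y_def using q(1) by (intro image_eqI[where x = "map q [0..<n]"]) auto
    have "trunc_ell1 n (ell1_nth x) - trunc_ell1 n q
        = (\<Sum>j<n. scale_ell1 (ell1_nth x j - q j) (unit_ell1 j))"
      by (simp add: trunc_ell1_def scale_ell1_diff sum_subtractf)
    also have "norm \<dots> \<le> (\<Sum>j<n. d)"
      using q(2) by (intro sum_norm_le) (simp add: norm_scale_ell1 dist_norm less_imp_le)
    also have "\<dots> \<le> e/2"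
      using e by (simp add: d_def field_simps)
    finally have "norm (x - trunc_ell1 n q) < e"
      using n norm_triangle_ineq[of "x - trunc_ell1 n (ell1_nth x)"
        "trunc_ell1 n (ell1_nth x) - trunc_ell1 n q"]
      by (simp add: norm_minus_commute)
    then show "\<exists>y\<in>Y. norm (x - y) < e" using mem by blast
  qed
qed

section \<open>Operators on \<open>ell1\<close> through their columns\<close>

text \<open>The rank-one operator whose matrix has \<open>y\<close> as column \<open>j\<close> and
  zeros elsewhere.\<close>

lift_definition col_op :: "nat \<Rightarrow> 'k::real_normed_field ell1 \<Rightarrow> 'k ell1 \<Rightarrow>\<^sub>L 'k ell1"
  is "\<lambda>j y x. scale_ell1 (ell1_nth x j) y"
  subgoal for j y
    by (rule bounded_linear_intro[where K = "norm y"])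
      (auto intro!: ell1_eqI mult_left_mono norm_ell1_nth_le
        simp: distrib_right norm_scale_ell1 mult.commute[of _ "norm y"])
  done

text \<open>On a truncation of \<open>x\<close>, the operator gives a combination of columns with
  the coefficients of \<open>x\<close>, so the triangle inequality yields the bound. Continuity
  carries it over to \<open>x\<close>.\<close>

lemma bounded_ops_ell1_norm_le:
  assumes T: "T \<in> bounded_ops_ell1" and M: "\<And>j. norm (blinfun_apply T (unit_ell1 j)) \<le> M"
  shows "norm T \<le> M"
proof (rule norm_blinfun_bound)
  show "0 \<le> M" using M[of 0] norm_ge_zero order_trans by blast
  fix x
  have "norm (blinfun_apply T (trunc_ell1 n (ell1_nth x))) \<le> M * norm x" for n
  proof -
    have "blinfun_apply T (trunc_ell1 n (ell1_nth x))
        = (\<Sum>j<n. scale_ell1 (ell1_nth x j) (blinfun_apply T (unit_ell1 j)))"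
      using T by (simp add: trunc_ell1_def blinfun.sum_right bounded_ops_ell1_def)
    also have "norm \<dots> \<le> (\<Sum>j<n. norm (ell1_nth x j) * M)"
      using M by (intro sum_norm_le) (simp add: norm_scale_ell1 mult_left_mono)
    also have "\<dots> \<le> norm x * M"
      unfolding sum_distrib_right[symmetric]
      using \<open>0 \<le> M\<close> by (intro mult_right_mono norm_ell1_sum_le) auto
    finally show ?thesis by (simp add: mult.commute)
  qed
  moreover have "(\<lambda>n. norm (blinfun_apply T (trunc_ell1 n (ell1_nth x)))) \<longlonglongrightarrow> norm (blinfun_apply T x)"
    by (intro tendsto_intros trunc_ell1_tendsto)
  ultimately show "norm (blinfun_apply T x) \<le> M * norm x"
    by (intro Lim_bounded) auto
qed

lemma ball_covering_property_ell1:
  "ball_covering_property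
    (bounded_ops_ell1 :: ('k::{real_normed_field, second_countable_topology} ell1 \<Rightarrow>\<^sub>L 'k ell1) set)"
proof -
  obtain Y :: "'k ell1 set"
    where Y: "countable Y" "\<And>x e. 0 < e \<Longrightarrow> \<exists>y\<in>Y. norm (x - y) < e"
    using ell1_separable by blast
  show ?thesis
  proof (rule ball_covering_property_coordinates[where
      A = "\<lambda>j T. blinfun_apply T (unit_ell1 j)" and R = col_op,
      OF subspace_bounded_ops_ell1 _ _ _ _ bounded_ops_ell1_norm_le Y])
    show "col_op j y \<in> bounded_ops_ell1" for j and y :: "'k ell1"
      by (auto simp: bounded_ops_ell1_def col_op.rep_eq mult.assoc intro: ell1_eqI)
    show "blinfun_apply (col_op j y) (unit_ell1 i) = (if i = j then y else 0)" for i j and y :: "'k ell1"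
      by (auto simp: col_op.rep_eq intro: ell1_eqI)
    show "norm (blinfun_apply T (unit_ell1 i)) \<le> norm T" for i and T :: "'k ell1 \<Rightarrow>\<^sub>L 'k ell1"
      using norm_blinfun[of T "unit_ell1 i"] by simp
  qed (auto simp: blinfun.diff_left)
qed

section \<open>Operators on \<open>c0\<close> through their rows\<close>

text \<open>Testing \<open>T\<close> on a vector of the unit ball whose entries cancel the phases of
  the row makes coordinate \<open>i\<close> of the image equal to the sum of absolute
  values.\<close>

lemma row_sum_le:
  fixes T :: "'k::real_normed_field c0 \<Rightarrow>\<^sub>L 'k c0"
  assumes T: "T \<in> bounded_ops_c0"
  shows "(\<Sum>j<n. norm (c0_nth (blinfun_apply T (unit_c0 j)) i)) \<le> norm T"
proof -
  define t where "t j = c0_nth (blinfun_apply T (unit_c0 j)) i" for j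
  \<comment> \<open>Where \<open>t j = 0\<close>, division by zero gives \<open>s j = 0\<close>, so
    \<open>s j * t j = norm (t j)\<close> and \<open>norm (s j) \<le> 1\<close> hold there as
    well.\<close>
  define s where "s j = of_real (norm (t j)) / t j" for j
  have "norm (s j) \<le> 1" for j
    by (simp add: s_def norm_divide)
  then have x: "norm (trunc_c0 n s) \<le> 1"
    by (intro norm_c0_leI) auto
  have "c0_nth (blinfun_apply T (trunc_c0 n s)) i = (\<Sum>j<n. s j * t j)"
    using T by (simp add: trunc_c0_def blinfun.sum_right bounded_ops_c0_def t_def)
  also have "\<dots> = of_real (\<Sum>j<n. norm (t j))"
    unfolding of_real_sum by (intro sum.cong) (auto simp: s_def)
  finally have "(\<Sum>j<n. norm (t j)) = norm (c0_nth (blinfun_apply T (trunc_c0 n s)) i)"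
    by (simp add: sum_nonneg del: of_real_sum)
  also have "\<dots> \<le> norm T * norm (trunc_c0 n s)"
    using norm_c0_nth_le norm_blinfun order_trans by blast
  also have "\<dots> \<le> norm T"
    using x by (simp add: mult_left_le)
  finally show ?thesis by (simp add: t_def)
qed

text \<open>For operators that are not \<open>'k\<close>-linear the sequence need not be summable, and \<open>op_row\<close> is
  unspecified.\<close>

definition op_row :: "nat \<Rightarrow> ('k::real_normed_field c0 \<Rightarrow>\<^sub>L 'k c0) \<Rightarrow> 'k ell1"
  where "op_row i T = Abs_ell1 (\<lambda>j. c0_nth (blinfun_apply T (unit_c0 j)) i)"

text \<open>The bound on the partial row sums makes the row summable, hence a genuine element of
  \<open>ell1\<close>.\<close>

lemma op_row_nth:
  assumes "T \<in> bounded_ops_c0"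
  shows "ell1_nth (op_row i T) j = c0_nth (blinfun_apply T (unit_c0 j)) i"
proof -
  have "summable (\<lambda>j. norm (c0_nth (blinfun_apply T (unit_c0 j)) i))"
    by (rule summableI_nonneg_bounded[OF _ row_sum_le[OF assms]]) simp
  then show ?thesis
    by (simp add: op_row_def Abs_ell1_inverse)
qed

lemma norm_op_row_le:
  assumes "T \<in> bounded_ops_c0"
  shows "norm (op_row i T) \<le> norm T"
  unfolding norm_ell1.rep_eq
  by (rule suminf_le_const[OF summable_ell1_nth]) (simp add: op_row_nth row_sum_le assms)

text \<open>Each coordinate of the image of a truncation is a finite sum bounded by
  \<open>norm x\<close> times the norm of a row. The supremum over coordinates keeps this bound, and
  truncations converge to \<open>x\<close>.\<close>

lemma bounded_ops_c0_norm_le: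
  assumes T: "T \<in> bounded_ops_c0" and M: "\<And>i. norm (op_row i T) \<le> M"
  shows "norm T \<le> M"
proof (rule norm_blinfun_bound)
  show "0 \<le> M" using M[of 0] norm_ge_zero order_trans by blast
  fix x
  have "norm (blinfun_apply T (trunc_c0 n (c0_nth x))) \<le> M * norm x" for n
  proof (rule norm_c0_leI)
    fix i
    have "c0_nth (blinfun_apply T (trunc_c0 n (c0_nth x))) i
        = (\<Sum>j<n. c0_nth x j * ell1_nth (op_row i T) j)"
      using T by (simp add: trunc_c0_def blinfun.sum_right bounded_ops_c0_def op_row_nth[OF T])
    also have "norm \<dots> \<le> (\<Sum>j<n. norm x * norm (ell1_nth (op_row i T) j))"
      by (intro sum_norm_le) (simp add: norm_mult mult_right_mono norm_c0_nth_le)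
    also have "\<dots> \<le> norm x * M"
      unfolding sum_distrib_left[symmetric]
      by (intro mult_left_mono order_trans[OF norm_ell1_sum_le M]) auto
    finally show "norm (c0_nth (blinfun_apply T (trunc_c0 n (c0_nth x))) i) \<le> M * norm x"
      by (simp add: mult.commute)
  qed
  moreover have "(\<lambda>n. norm (blinfun_apply T (trunc_c0 n (c0_nth x)))) \<longlonglongrightarrow> norm (blinfun_apply T x)"
    by (intro tendsto_intros trunc_c0_tendsto)
  ultimately show "norm (blinfun_apply T x) \<le> M * norm x"
    by (intro Lim_bounded) auto
qed

section \<open>Duality between \<open>ell1\<close> and \<open>c0\<close>, and operators with a
  single row\<close>

text \<open>The bilinear duality through which \<open>ell1\<close> acts on \<open>c0\<close> by
  functionals; over the complex numbers there is no conjugation.\<close>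

definition pairing :: "'k::real_normed_field ell1 \<Rightarrow> 'k c0 \<Rightarrow> 'k"
  where "pairing y x = (\<Sum>j. ell1_nth y j * c0_nth x j)"

context
  fixes y :: "'k::{real_normed_field, banach} ell1" and x :: "'k c0"
begin

lemma summable_norm_pairing: "summable (\<lambda>j. norm (ell1_nth y j * c0_nth x j))"
  by (rule summable_comparison_test'[OF summable_mult2[OF summable_ell1_nth[of y], of "norm x"]])
    (simp add: norm_mult mult_left_mono norm_c0_nth_le)

text \<open>Completeness of the field, from the sort \<open>banach\<close>, turns absolute
  convergence into convergence.\<close>

lemma summable_pairing: "summable (\<lambda>j. ell1_nth y j * c0_nth x j)"
  by (rule summable_norm_cancel[OF summable_norm_pairing])

lemma norm_pairing_le: "norm (pairing y x) \<le> norm y * norm x"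
proof -
  have "norm (pairing y x) \<le> (\<Sum>j. norm (ell1_nth y j * c0_nth x j))"
    unfolding pairing_def by (rule summable_norm[OF summable_norm_pairing])
  also have "\<dots> \<le> (\<Sum>j. norm (ell1_nth y j) * norm x)"
    by (intro suminf_le summable_norm_pairing summable_mult2 summable_ell1_nth)
      (simp add: norm_mult mult_left_mono norm_c0_nth_le)
  also have "\<dots> = norm y * norm x"
    unfolding norm_ell1.rep_eq by (simp add: suminf_mult2[symmetric] summable_ell1_nth)
  finally show ?thesis .
qed

end

lemma pairing_add: "pairing y (x + z) = pairing y x + pairing y z"
  for y :: "'k::{real_normed_field, banach} ell1"
  by (simp add: pairing_def distrib_left suminf_add summable_pairing)

lemma pairing_scale: "pairing y (scale_c0 c x) = c * pairing y x"
  for y :: "'k::{real_normed_field, banach} ell1"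
  by (simp add: pairing_def mult.left_commute suminf_mult summable_pairing)

lemma pairing_scaleR: "pairing y (r *\<^sub>R x) = r *\<^sub>R pairing y x"
  for y :: "'k::{real_normed_field, banach} ell1"
  by (simp add: pairing_def suminf_scaleR_right summable_pairing)

lemma pairing_unit: "pairing y (unit_c0 j) = ell1_nth y j"
  unfolding pairing_def by (subst suminf_finite[of "{j}"]) auto

text \<open>The rank-one operator whose matrix has \<open>y\<close> as row \<open>i\<close> and
  zeros elsewhere.\<close>

lift_definition row_op :: "nat \<Rightarrow> 'k::{real_normed_field, banach} ell1 \<Rightarrow> 'k c0 \<Rightarrow>\<^sub>L 'k c0"
  is "\<lambda>i y x. scale_c0 (pairing y x) (unit_c0 i)"
  subgoal for i y
    by (rule bounded_linear_intro[where K = "norm y"])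
      (auto intro!: c0_eqI norm_c0_leI
        simp: pairing_add pairing_scaleR distrib_right norm_pairing_le mult.commute[of _ "norm y"])
  done

lemma row_op_bounded_ops_c0: "row_op i y \<in> bounded_ops_c0"
  by (auto simp: bounded_ops_c0_def row_op.rep_eq pairing_scale intro: c0_eqI)

lemma ball_covering_property_c0:
  "ball_covering_property
    (bounded_ops_c0 :: ('k::{real_normed_field, banach, second_countable_topology} c0 \<Rightarrow>\<^sub>L 'k c0) set)"
proof -
  obtain Y :: "'k ell1 set"
    where Y: "countable Y" "\<And>x e. 0 < e \<Longrightarrow> \<exists>y\<in>Y. norm (x - y) < e"
    using ell1_separable by blast
  show ?thesis
  proof (rule ball_covering_property_coordinates[where A = op_row and R = row_op,
      OF subspace_bounded_ops_c0 row_op_bounded_ops_c0 _ _ norm_op_row_le bounded_ops_c0_norm_le Y])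
    show "op_row i (row_op j y) = (if i = j then y else 0)" for i j and y :: "'k ell1"
      by (rule ell1_eqI) (auto simp: op_row_nth row_op_bounded_ops_c0 row_op.rep_eq pairing_unit)
    show "op_row i (S - T) = op_row i S - op_row i T"
      if "S \<in> bounded_ops_c0" "T \<in> bounded_ops_c0" for i and S T :: "'k c0 \<Rightarrow>\<^sub>L 'k c0"
      \<comment> \<open>\<open>op_row_nth\<close> speaks only about members of
        \<open>bounded_ops_c0\<close>, so \<open>S - T\<close> must be known to be one.\<close>
      using that subspace_diff[OF subspace_bounded_ops_c0 that]
      by (intro ell1_eqI) (simp add: op_row_nth blinfun.diff_left)
  qed
qed

theorem corollary3p4:
  "ball_covering_property (bounded_ops_ell1 :: (real ell1 \<Rightarrow>\<^sub>L real ell1) set) \<and>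
   ball_covering_property (bounded_ops_c0 :: (real c0 \<Rightarrow>\<^sub>L real c0) set) \<and>
   ball_covering_property (bounded_ops_ell1 :: (complex ell1 \<Rightarrow>\<^sub>L complex ell1) set) \<and>
   ball_covering_property (bounded_ops_c0 :: (complex c0 \<Rightarrow>\<^sub>L complex c0) set)"
  by (intro conjI ball_covering_property_ell1 ball_covering_property_c0)

end
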